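(* Let $\ell:\mathbb{R}^r\to\mathbb{R}$ be twice differentiable (the loss as a function of the vector of basis singular values), and assume that its Hessian is $\rho$-Lipschitz: $\|\nabla^2\ell(\mathbf{x})-\nabla^2\ell(\mathbf{y})\|_2\le\rho\|\mathbf{x}-\mathbf{y}\|_2$ for all $\mathbf{x},\mathbf{y}\in\mathbb{R}^r$. Let $\mathbf{s}=(s_1,\dots,s_r)\in\mathbb{R}^r$ be the vector of singular values, let $i\in\{1,\dots,r\}$, let $g_i=\frac{\partial\ell}{\partial s_i}(\mathbf{s})$ and let $H_{ii}$ be the $i$-th diagonal element of $\nabla^2\ell(\mathbf{s})$. Let $0<\varepsilon<1$ and let $\widehat H_{ii}\in\mathbb{R}$ be an estimate of $H_{ii}$ with maximum relative error $\varepsilon$: $$|\widehat H_{ii}-H_{ii}|\le\varepsilon|H_{ii}|.$$ Then the change in loss $\Delta\ell:=\ell(\mathbf{s}-s_i\mathbf{e}_i)-\ell(\mathbf{s})$ caused by pruning basis $i$ (replacing $s_i$ by $0$) satisfies $$|\Delta\ell|\le\left|-g_is_i+\tfrac12\widehat H_{ii}s_i^2\right|+\frac{\varepsilon}{2(1-\varepsilon)}|\widehat H_{ii}|\,s_i^2+\frac{\rho}{6}|s_i|^3.$$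
   Context: $\mathbf{e}_i\in\mathbb{R}^r$ is the $i$-th standard basis vector. For matrices $\|\cdot\|_2$ is the operator (spectral) norm; for vectors it is the Euclidean norm. *)

theory Defs
  imports "HOL-Analysis.Analysis"
begin

definition partial_derivative :: "(real ^ 'n \<Rightarrow> real) \<Rightarrow> 'n \<Rightarrow> real ^ 'n \<Rightarrow> real" where
  "partial_derivative f i x = deriv (\<lambda>t. f (x + t *\<^sub>R axis i 1)) 0"

definition gradient :: "(real ^ 'n \<Rightarrow> real) \<Rightarrow> real ^ 'n \<Rightarrow> real ^ 'n" where
  "gradient f x = (\<chi> i. partial_derivative f i x)"

(* Frechet differentiability, both of f and of its gradient, is required;
   the mere existence of second-order partial derivatives would be weaker. *)
definition twice_differentiable :: "(real ^ 'n \<Rightarrow> real) \<Rightarrow> bool" where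
  "twice_differentiable f \<longleftrightarrow>
     (\<forall>x. f differentiable (at x)) \<and> (\<forall>x. gradient f differentiable (at x))"

(* The index order makes this the Jacobian matrix of the gradient (rows indexed by
   the gradient component); it is symmetric when f is twice differentiable. *)
definition hessian :: "(real ^ 'n \<Rightarrow> real) \<Rightarrow> real ^ 'n \<Rightarrow> real ^ 'n ^ 'n" where
  "hessian f x = (\<chi> i j. partial_derivative (partial_derivative f i) j x)"

definition spectral_norm :: "real ^ 'n ^ 'm \<Rightarrow> real" where
  "spectral_norm A = onorm (\<lambda>v. A *v v)"

lemma partial_derivative_frechet:
  assumes "(f has_derivative f') (at x)"
  shows "partial_derivative f i x = f' (axis i 1)"
proof -
  have lin: "linear f'" using assms by (rule has_derivative_linear)
  have "((\<lambda>t::real. x + t *\<^sub>R axis i 1) has_derivative (\<lambda>t. t *\<^sub>R axis i 1)) (at 0)"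
    by (auto intro!: derivative_eq_intros)
  moreover have "(f has_derivative f') (at (x + 0 *\<^sub>R axis i 1))"
    using assms by simp
  ultimately have "((\<lambda>t::real. f (x + t *\<^sub>R axis i 1)) has_derivative
      (\<lambda>t. f' (t *\<^sub>R axis i 1))) (at 0)"
    by (rule has_derivative_compose)
  then have "((\<lambda>t::real. f (x + t *\<^sub>R axis i 1)) has_field_derivative f' (axis i 1)) (at 0)"
    by (simp add: has_field_derivative_def linear_scale[OF lin] mult_commute_abs)
  then show ?thesis
    unfolding partial_derivative_def by (rule DERIV_imp_deriv)
qed

lemma twice_differentiable_GDERIV:
  assumes "twice_differentiable f"
  shows "GDERIV f x :> gradient f x"
proof -
  obtain f' where f': "(f has_derivative f') (at x)"
    using assms unfolding twice_differentiable_def differentiable_def by blast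
  have lin: "linear f'" using f' by (rule has_derivative_linear)
  have "f' h = h \<bullet> gradient f x" for h
  proof -
    have "f' h = f' (\<Sum>i\<in>UNIV. h $ i *\<^sub>R axis i 1)"
      using basis_expansion[of h] by (simp add: scalar_mult_eq_scaleR)
    also have "\<dots> = (\<Sum>i\<in>UNIV. h $ i * f' (axis i 1))"
      by (simp add: linear_sum[OF lin] linear_scale[OF lin])
    also have "\<dots> = h \<bullet> gradient f x"
      by (simp add: inner_vec_def gradient_def partial_derivative_frechet[OF f'])
    finally show ?thesis .
  qed
  then have "f' = (\<lambda>h. h \<bullet> gradient f x)" by blast
  with f' show ?thesis by (simp add: gderiv_def)
qed

lemma twice_differentiable_hessian:
  assumes "twice_differentiable f"
  shows "(gradient f has_derivative (\<lambda>h. hessian f x *v h)) (at x)"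
proof -
  obtain D where D: "(gradient f has_derivative D) (at x)"
    using assms unfolding twice_differentiable_def differentiable_def by blast
  have lin: "linear D" using D by (rule has_derivative_linear)
  have "hessian f x $ i $ j = matrix D $ i $ j" for i j
  proof -
    have "((\<lambda>y. gradient f y $ i) has_derivative (\<lambda>h. D h $ i)) (at x)"
      by (rule bounded_linear.has_derivative[OF bounded_linear_vec_nth D])
    then have "(partial_derivative f i has_derivative (\<lambda>h. D h $ i)) (at x)"
      by (simp add: gradient_def)
    from partial_derivative_frechet[OF this, of j] show ?thesis
      by (simp add: hessian_def matrix_def)
  qed
  then have "hessian f x = matrix D" by (simp add: vec_eq_iff)
  then have "(\<lambda>h. hessian f x *v h) = D"
    using matrix_works[of D] lin
    by (simp add: linear_def scalar_mult_eq_scaleR[abs_def])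
  with D show ?thesis by simp
qed

end

theory Submission
  imports Defs
begin

text \<open>Restricting \<open>l\<close> to the segment from \<open>s\<close> in direction \<open>v\<close> turns the Lipschitz
  Hessian into the pointwise bound \<open>\<rho> \<parallel>v\<parallel>\<^sup>3 t\<close> on the variation of the second derivative;
  integrating it twice (by monotonicity) gives the cubic Taylor remainder. With \<open>v = - s\<^sub>i e\<^sub>i\<close>
  it remains to replace \<open>H\<^sub>i\<^sub>i\<close> by its estimate, using \<open>(1 - \<epsilon>) \<bar>H\<^sub>i\<^sub>i\<bar> \<le> \<bar>Hhat\<bar>\<close>.\<close>

text \<open>Subtracting the quadratic Taylor polynomial and the cubic \<open>M * t ^ 3 / 6\<close>
  from \<open>f\<close> leaves a function whose second derivative is nonpositive on [0, 1]. Two uses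
  of monotonicity stand in for the double integral, so integrability of \<open>f''\<close> never
  arises.\<close>

lemma taylor2_remainder_le:
  fixes f f' f'' :: "real \<Rightarrow> real"
  assumes f: "\<And>t. (f has_real_derivative f' t) (at t)"
    and f': "\<And>t. (f' has_real_derivative f'' t) (at t)"
    and le: "\<And>t. \<lbrakk>0 \<le> t; t \<le> 1\<rbrakk> \<Longrightarrow> f'' t - f'' 0 \<le> M * t"
  shows "f 1 - f 0 - f' 0 - f'' 0 / 2 \<le> M / 6"
proof -
  \<comment> \<open>\<open>g'\<close> is the derivative of \<open>g\<close> and vanishes at 0; the
    claim is exactly \<open>g 1 \<le> g 0\<close>.\<close>
  define g' where "g' t = f' t - f' 0 - t * f'' 0 - M * t\<^sup>2 / 2" for t
  define g where "g t = f t - t * f' 0 - t\<^sup>2 * f'' 0 / 2 - M * t ^ 3 / 6" for t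
  have dg': "(g' has_real_derivative f'' t - f'' 0 - M * t) (at t)" for t
    unfolding g'_def by (auto intro!: derivative_eq_intros f')
  have dg: "(g has_real_derivative g' t) (at t)" for t
    unfolding g_def g'_def
    by (auto intro!: derivative_eq_intros f simp: field_simps power2_eq_square)
  have nonpos: "g' t \<le> 0" if "0 \<le> t" "t \<le> 1" for t
  proof -
    have "g' t \<le> g' 0"
      using that le by (intro DERIV_nonpos_imp_nonincreasing[of 0 t g'])
        (auto intro!: exI dg' simp: algebra_simps)
    then show ?thesis by (simp add: g'_def)
  qed
  have "g 1 \<le> g 0"
    using dg nonpos by (intro DERIV_nonpos_imp_nonincreasing[of 0 1 g]) auto
  then show ?thesis by (simp add: g_def)
qed

text \<open>The hypothesis is symmetric under negation, so the one-sided bound applies to both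
  \<open>f\<close> and \<open>- f\<close>.\<close>

lemma taylor2_remainder_abs_le:
  fixes f f' f'' :: "real \<Rightarrow> real"
  assumes f: "\<And>t. (f has_real_derivative f' t) (at t)"
    and f': "\<And>t. (f' has_real_derivative f'' t) (at t)"
    and le: "\<And>t. \<lbrakk>0 \<le> t; t \<le> 1\<rbrakk> \<Longrightarrow> \<bar>f'' t - f'' 0\<bar> \<le> M * t"
  shows "\<bar>f 1 - f 0 - f' 0 - f'' 0 / 2\<bar> \<le> M / 6"
proof -
  have "f 1 - f 0 - f' 0 - f'' 0 / 2 \<le> M / 6"
    using le by (intro taylor2_remainder_le f f') (simp add: abs_le_iff)
  moreover have "- f 1 - - f 0 - - f' 0 - - f'' 0 / 2 \<le> M / 6"
  proof (rule taylor2_remainder_le[where f = "\<lambda>t. - f t" and f' = "\<lambda>t. - f' t"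
        and f'' = "\<lambda>t. - f'' t"])
    show "- f'' t - - f'' 0 \<le> M * t" if "0 \<le> t" "t \<le> 1" for t
      using le[OF that] by (simp add: abs_le_iff)
  qed (auto intro: DERIV_minus f f')
  ultimately show ?thesis by linarith
qed

text \<open>Cauchy-Schwarz followed by the operator norm bound. It carries the Lipschitz condition
  on matrices over to second derivatives along a line.\<close>

lemma abs_quadratic_form_le_spectral_norm:
  fixes A :: "real ^ 'n ^ 'n"
  shows "\<bar>v \<bullet> (A *v v)\<bar> \<le> spectral_norm A * (norm v)\<^sup>2"
proof -
  have "\<bar>v \<bullet> (A *v v)\<bar> \<le> norm v * norm (A *v v)"
    by (rule Cauchy_Schwarz_ineq2)
  also have "\<dots> \<le> norm v * (spectral_norm A * norm v)"
    unfolding spectral_norm_def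
    by (intro mult_left_mono onorm matrix_vector_mul_bounded_linear) simp
  finally show ?thesis by (simp add: power2_eq_square mult_ac)
qed

lemma lipschitz_hessian_taylor_bound:
  fixes l :: "real ^ 'n \<Rightarrow> real"
  assumes l: "twice_differentiable l"
    and lip: "\<And>x y. spectral_norm (hessian l x - hessian l y) \<le> \<rho> * norm (x - y)"
  shows "\<bar>l (s + v) - l s - v \<bullet> gradient l s - v \<bullet> (hessian l s *v v) / 2\<bar>
           \<le> \<rho> / 6 * norm v ^ 3"
proof -
  define f where "f t = l (s + t *\<^sub>R v)" for t
  define f' where "f' t = v \<bullet> gradient l (s + t *\<^sub>R v)" for t
  define f'' where "f'' t = v \<bullet> (hessian l (s + t *\<^sub>R v) *v v)" for t
  have line: "((\<lambda>t. s + t *\<^sub>R v) has_derivative (\<lambda>h. h *\<^sub>R v)) (at t)" for t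
    by (auto intro!: derivative_eq_intros)
  have df: "(f has_real_derivative f' t) (at t)" for t
    using has_derivative_compose[OF line
        twice_differentiable_GDERIV[OF l, unfolded gderiv_def]]
    by (simp add: f_def[abs_def] f'_def has_field_derivative_def mult_commute_abs)
  have df': "(f' has_real_derivative f'' t) (at t)" for t
    using has_derivative_inner_right[OF
        has_derivative_compose[OF line twice_differentiable_hessian[OF l]], of v t]
    by (simp add: f'_def[abs_def] f''_def has_field_derivative_def mult_commute_abs
        matrix_vector_mult_scaleR)
  \<comment> \<open>Two factors \<open>norm v\<close> come from the quadratic form, the third from
    the displacement \<open>t *\<^sub>R v\<close> in the Lipschitz condition.\<close>
  have "\<bar>f'' t - f'' 0\<bar> \<le> (\<rho> * norm v ^ 3) * t" if "0 \<le> t" for t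
  proof -
    have "\<bar>f'' t - f'' 0\<bar> = \<bar>v \<bullet> ((hessian l (s + t *\<^sub>R v) - hessian l s) *v v)\<bar>"
      by (simp add: f''_def matrix_vector_mult_diff_rdistrib inner_diff_right)
    also have "\<dots> \<le> spectral_norm (hessian l (s + t *\<^sub>R v) - hessian l s) * (norm v)\<^sup>2"
      by (rule abs_quadratic_form_le_spectral_norm)
    also have "\<dots> \<le> (\<rho> * norm ((s + t *\<^sub>R v) - s)) * (norm v)\<^sup>2"
      by (intro mult_right_mono lip) simp
    also have "\<dots> = (\<rho> * norm v ^ 3) * t"
      using that by (simp add: power2_eq_square power3_eq_cube)
    finally show ?thesis .
  qed
  from taylor2_remainder_abs_le[OF df df' this]
  show ?thesis by (simp add: f_def f'_def f''_def)
qed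

theorem theorem7:
  fixes l :: "real ^ 'r \<Rightarrow> real"
    and s :: "real ^ 'r"
    and i :: 'r
    and \<rho> \<epsilon> Hhat :: real
  assumes "twice_differentiable l"
    and "\<And>x y. spectral_norm (hessian l x - hessian l y) \<le> \<rho> * norm (x - y)"
    and "0 < \<epsilon>" and "\<epsilon> < 1"
    and "\<bar>Hhat - hessian l s $ i $ i\<bar> \<le> \<epsilon> * \<bar>hessian l s $ i $ i\<bar>"
  shows "\<bar>l (s - (s $ i) *\<^sub>R axis i 1) - l s\<bar>
           \<le> \<bar>- partial_derivative l i s * (s $ i) + 1 / 2 * Hhat * (s $ i)\<^sup>2\<bar>
             + \<epsilon> / (2 * (1 - \<epsilon>)) * \<bar>Hhat\<bar> * (s $ i)\<^sup>2
             + \<rho> / 6 * \<bar>s $ i\<bar> ^ 3"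
proof -
  define a where "a = s $ i"
  define H where "H = hessian l s $ i $ i"
  define g where "g = partial_derivative l i s"
  define v :: "real ^ 'r" where "v = - a *\<^sub>R axis i 1"
  \<comment> \<open>Since \<open>v\<close> is a multiple of a basis vector, only the diagonal entry
    survives; its sign cancels here but not in the linear term.\<close>
  have quad: "v \<bullet> (hessian l s *v v) = H * a\<^sup>2"
    unfolding v_def matrix_vector_mult_scaleR
    by (simp add: H_def inner_axis' matrix_vector_mult_basis column_def power2_eq_square)
  have lin: "v \<bullet> gradient l s = - g * a"
    by (simp add: v_def g_def inner_axis' gradient_def)
  have norm: "norm v = \<bar>a\<bar>" and pruned: "s + v = s - a *\<^sub>R axis i 1"
    by (simp_all add: v_def)
  have taylor:
    "\<bar>l (s - a *\<^sub>R axis i 1) - l s - (- g * a + H * a\<^sup>2 / 2)\<bar> \<le> \<rho> / 6 * \<bar>a\<bar> ^ 3"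
    using lipschitz_hessian_taylor_bound[OF assms(1,2), of s v]
    unfolding quad lin norm pruned by linarith
  have err: "\<bar>Hhat - H\<bar> \<le> \<epsilon> * \<bar>H\<bar>"
    using assms(5) by (simp add: H_def)
  \<comment> \<open>By the triangle inequality \<bar>H\<bar> - \<bar>Hhat\<bar> is at most the
    estimation error. This trades the unknown \<open>H\<close> for \<open>Hhat\<close> at the cost
    of a factor 1 / (1 - \<epsilon>).\<close>
  then have "(1 - \<epsilon>) * \<bar>H\<bar> \<le> \<bar>Hhat\<bar>"
    by (simp add: algebra_simps)
  then have "\<bar>H\<bar> \<le> \<bar>Hhat\<bar> / (1 - \<epsilon>)"
    using assms(4) by (simp add: pos_le_divide_eq mult.commute)
  with err have "\<bar>H - Hhat\<bar> \<le> \<epsilon> * (\<bar>Hhat\<bar> / (1 - \<epsilon>))"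
    using assms(3) by (smt (verit) mult_left_mono)
  then have "\<bar>H - Hhat\<bar> * (a\<^sup>2 / 2) \<le> \<epsilon> * (\<bar>Hhat\<bar> / (1 - \<epsilon>)) * (a\<^sup>2 / 2)"
    by (intro mult_right_mono) simp_all
  then have "\<bar>(H - Hhat) * (a\<^sup>2 / 2)\<bar> \<le> \<epsilon> / (2 * (1 - \<epsilon>)) * \<bar>Hhat\<bar> * a\<^sup>2"
    by (simp add: abs_mult mult.commute)
  \<comment> \<open>The curvature error is the gap between the exact and the estimated quadratic
    model. The loss change is thus the estimated model plus this gap plus the Taylor remainder, and
    the triangle inequality finishes.\<close>
  moreover have "(H - Hhat) * (a\<^sup>2 / 2) = (- g * a + H * a\<^sup>2 / 2) - (- g * a + 1 / 2 * Hhat * a\<^sup>2)"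
    by (simp add: field_simps)
  ultimately show ?thesis
    using taylor unfolding a_def[symmetric] g_def[symmetric] by linarith
qed

end
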